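(* Let $d\in\mathbb{N}\cup\{0\}$ and let $p_n\in(0,1)$ be a sequence of the form $$p_n=n^{-\frac{2}{(d+1)^2}+o(1)}\qquad(n\to\infty).$$ Let $\mathbf{D}_{n,p_n}$ be the degree of a uniformly chosen vertex of the random cluster graph $\mathbf{CG}_{n,p_n}$. Then $$\lim_{n\to\infty}\mathbb{P}(\mathbf{D}_{n,p_n}=d)=1.$$ Furthermore, for any fixed $d'\in\mathbb{N}\cup\{0\}$ with $d'\neq d$, $$\mathbb{P}(\mathbf{D}_{n,p_n}=d')=n^{-\left(\frac{d'-d}{d+1}\right)^2+o(1)}.$$
   Context: A cluster graph is a simple undirected graph on the labelled vertex set $\{1,\dots,n\}$ every connected component of which is a complete graph. For $p\in(0,1)$, the random cluster graph $\mathbf{CG}_{n,p}$ is the Erdős–Rényi random graph on $n$ vertices with edge probability $p$ (each of the $\binom n2$ edges present independently with probability $p$), conditioned on the event that it is a cluster graph. The uniform vertex is chosen independently of the graph. The notation $a_n=n^{c+o(1)}$ means $\log a_n/\log n\to c$. *)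

theory Defs
  imports "HOL-Probability.Probability"
begin

text \<open>A simple undirected graph on the vertex set \<open>{1..n}\<close> is represented by its edge set,
  a subset of \<open>possible_edges n\<close>.\<close>

definition possible_edges :: "nat \<Rightarrow> nat set set" where
  "possible_edges n = {e. e \<subseteq> {1..n} \<and> card e = 2}"

definition adjacent :: "nat set set \<Rightarrow> nat \<Rightarrow> nat \<Rightarrow> bool" where
  "adjacent E u v \<longleftrightarrow> u \<noteq> v \<and> {u, v} \<in> E"

definition vertex_degree :: "nat set set \<Rightarrow> nat \<Rightarrow> nat" where
  "vertex_degree E v = card {u. adjacent E v u}"

definition components :: "nat \<Rightarrow> nat set set \<Rightarrow> nat set set" where
  "components n E = (\<lambda>v. {u. (adjacent E)\<^sup>*\<^sup>* v u}) ` {1..n}"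

definition complete_on :: "nat set set \<Rightarrow> nat set \<Rightarrow> bool" where
  "complete_on E C \<longleftrightarrow> (\<forall>u\<in>C. \<forall>v\<in>C. u \<noteq> v \<longrightarrow> adjacent E u v)"

definition cluster_graph :: "nat \<Rightarrow> nat set set \<Rightarrow> bool" where
  "cluster_graph n E \<longleftrightarrow> E \<subseteq> possible_edges n \<and> (\<forall>C\<in>components n E. complete_on E C)"

definition erdos_renyi :: "nat \<Rightarrow> real \<Rightarrow> nat set set pmf" where
  "erdos_renyi n p =
     map_pmf (\<lambda>f. {e \<in> possible_edges n. f e})
       (Pi_pmf (possible_edges n) False (\<lambda>_. bernoulli_pmf p))"

text \<open>Here \<^const>\<open>cond_pmf\<close> is meaningful only if the conditioning event has positive
  probability; see \<open>cluster_graph_possible\<close> below.\<close>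

definition random_cluster_graph :: "nat \<Rightarrow> real \<Rightarrow> nat set set pmf" where
  "random_cluster_graph n p = cond_pmf (erdos_renyi n p) {E. cluster_graph n E}"

definition random_degree :: "nat \<Rightarrow> real \<Rightarrow> nat pmf" where
  "random_degree n p =
     map_pmf (\<lambda>(E, v). vertex_degree E v) (pair_pmf (random_cluster_graph n p) (pmf_of_set {1..n}))"

text \<open>\<open>a\<^sub>n = n powr (c + o(1))\<close>. Positivity is explicit because \<open>ln 0 = 0\<close> in HOL.\<close>

definition power_law :: "(nat \<Rightarrow> real) \<Rightarrow> real \<Rightarrow> bool" where
  "power_law a c \<longleftrightarrow>
     (\<forall>\<^sub>F n in sequentially. a n > 0) \<and> (\<lambda>n. ln (a n) / ln (real n)) \<longlonglongrightarrow> c"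

lemma finite_possible_edges: "finite (possible_edges n)"
  by (rule finite_subset[of _ "Pow {1..n}"]) (auto simp: possible_edges_def)

lemma cluster_graph_empty: "cluster_graph n {}"
proof -
  have "u = v" if "(adjacent {})\<^sup>*\<^sup>* v u" for u v
    using that by (induction rule: rtranclp_induct) (auto simp: adjacent_def)
  then show ?thesis
    unfolding cluster_graph_def components_def complete_on_def by auto
qed

lemma cluster_graph_possible:
  assumes "0 < p" "p < 1"
  shows "set_pmf (erdos_renyi n p) \<inter> {E. cluster_graph n E} \<noteq> {}"
proof -
  have "(\<lambda>_. False) \<in> set_pmf (Pi_pmf (possible_edges n) False (\<lambda>_. bernoulli_pmf p))"
    using assms by (simp add: set_Pi_pmf finite_possible_edges PiE_dflt_def)
  then have "{} \<in> set_pmf (erdos_renyi n p)"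
    unfolding erdos_renyi_def by (force simp: image_iff)
  then show ?thesis
    using cluster_graph_empty by blast
qed

end

theory Submission
  imports Defs "HOL-Real_Asymp.Real_Asymp"
begin

text \<open>Write \<open>r = p / (1 - p)\<close>, \<open>Z\<^sub>N\<close> for the sum of \<open>r ^ card E\<close> over the cluster graphs
  \<open>E\<close> on \<open>N\<close> vertices, and \<open>c\<^sub>N = Z\<^sub>N / N!\<close>. Deleting the clique of a vertex shows that the
  degree is \<open>k - 1\<close> with probability \<open>X\<^sub>k c\<^sub>n\<^sub>-\<^sub>k / (n c\<^sub>n)\<close>, where
  \<open>X\<^sub>k = r ^ (k choose 2) / (k - 1)!\<close>. In terms of generating functions,
  \<open>\<Sum> c\<^sub>N x ^ N = exp (\<Sum> X\<^sub>k x ^ k / k)\<close>, and since \<open>X\<close> is log-concave, a theorem of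
  Bender and Canfield gives that \<open>c\<^sub>N\<close> is log-concave while \<open>N! c\<^sub>N\<close> is log-convex. Hence
  \<open>c\<^sub>n\<^sub>-\<^sub>k / c\<^sub>n\<close> is at most \<open>x ^ k\<close>, and asymptotic to it for fixed \<open>k\<close>, with
  \<open>x = c\<^sub>n\<^sub>-\<^sub>1 / c\<^sub>n\<close>.

  Let \<open>m = d + 1\<close>, so that \<open>r = n powr (- 2 / m\<^sup>2 + o(1))\<close>. The probability of degree \<open>d\<close> being at
  most \<open>1\<close> forces \<open>x \<le> n powr ((2 m - 1) / m\<^sup>2 + o(1))\<close>; then the exponent of the probability of
  degree \<open>k - 1\<close> is at most \<open>- (((k - m) / m)\<^sup>2)\<close> up to an error \<open>o(1) k\<^sup>2\<close>, and the factor
  \<open>1 / (k - 1)!\<close> makes the contributions of all \<open>k \<noteq> m\<close> sum to \<open>o(1)\<close>. So degree \<open>d\<close> has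
  probability tending to \<open>1\<close>, which in turn determines \<open>x\<close> and all the exponents.\<close>

subsection \<open>Log-concavity of exponentials of generating functions\<close>

text \<open>Log-concavity means that successive ratios decrease. The hypothesis is confined to
  \<open>i \<le> l < j\<close> so that the lemma can serve inside an induction proving
  log-concavity.\<close>

lemma log_concave_ratio_antimono:
  fixes f :: "nat \<Rightarrow> real"
  assumes "i \<le> j" "\<And>l. f l > 0"
    and "\<And>l. i \<le> l \<Longrightarrow> l < j \<Longrightarrow> f l * f (l + 2) \<le> (f (l + 1))\<^sup>2"
  shows "f i * f (j + 1) \<le> f j * f (i + 1)"
  using assms(1,3)
proof (induction j rule: dec_induct)
  case base
  then show ?case by simp
next
  case (step j)
  have IH: "f i * f (j + 1) \<le> f j * f (i + 1)" using step by auto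
  have "f i * f (j + 2) * f j = f i * (f j * f (j + 2))" by simp
  also have "\<dots> \<le> f i * (f (j + 1))\<^sup>2"
    using step.prems[of j] step.hyps assms(2)[of i] by (intro mult_left_mono) auto
  also have "\<dots> = (f i * f (j + 1)) * f (j + 1)" by (simp add: power2_eq_square)
  also have "\<dots> \<le> (f j * f (i + 1)) * f (j + 1)"
    using IH assms(2)[of "j+1"] by (intro mult_right_mono) auto
  finally have "f j * (f i * f (j + 2)) \<le> f j * (f (j + 1) * f (i + 1))" by (simp add: mult_ac)
  then show ?case using assms(2)[of j] by simp
qed

text \<open>\<open>c_rec\<close> is the coefficient form of
  \<open>x C' = C * (X 1 * x + X 2 * x^2 + ...)\<close>, so up to scale \<open>C\<close> is the
  exponential of the series with coefficients \<open>X k / k\<close>. The value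
  \<open>X 0 = 1\<close> lies outside that series; with log-concavity at 0 it encodes
  \<open>X 2 \<le> (X 1)^2\<close>.\<close>

locale log_concave_exponential =
  fixes X c :: "nat \<Rightarrow> real"
  assumes X_0: "X 0 = 1" and X_pos: "X k > 0"
    and X_log_concave: "X k * X (k + 2) \<le> (X (k + 1))\<^sup>2"
    and c_0: "c 0 > 0"
    and c_rec: "real (Suc n) * c (Suc n) = (\<Sum>k\<le>n. X (Suc k) * c (n - k))"
begin

lemma c_pos: "c n > 0"
proof (induction n rule: less_induct)
  case (less n)
  show ?case
  proof (cases n)
    case (Suc m)
    have "0 < real (Suc m) * c (Suc m)"
      unfolding c_rec using less Suc by (intro sum_pos mult_pos_pos X_pos) auto
    then show ?thesis using Suc by (simp add: zero_less_mult_iff)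
  qed (simp add: c_0)
qed

text \<open>Using \<open>X 0 = 1\<close>, the difference of the two sides, multiplied by
  \<open>(n + 1) * (n + 2)\<close>, is a double sum over products of \<open>2 \<times> 2\<close> minors.\<close>

lemma c_log_concave: "c n * c (n + 2) \<le> (c (n + 1))\<^sup>2"
proof (induction n rule: less_induct)
  case (less n)
  define N where "N = n + 1"
  define a where "a k = c (N - k)" for k
  \<comment> \<open>The zero at \<open>j = N\<close> stands for a coefficient of index -1; truncated
    subtraction would give \<open>c 0\<close>.\<close>
  define b where "b j = (if j < N then c (n - j) else 0)" for j
  define m where "m k j = X k * X (j + 1) - X (k + 1) * X j" for k j
  have m_nonneg: "m k j \<ge> 0" if "j \<le> k" for j k
    using log_concave_ratio_antimono[of j k X] that X_pos X_log_concave
    by (auto simp: m_def mult_ac)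
  have ab_nonneg: "a k * b j - a j * b k \<ge> 0" if "j < k" "k \<le> N" for j k
  proof (cases "k = N")
    case False
    define i l where "i = n - k" and "l = n - j"
    \<comment> \<open>Only log-concavity at indices from \<open>n - k\<close> to
      \<open>n - j - 1\<close> enters; these are below \<open>n\<close>, so the induction hypothesis
      covers them.\<close>
    have "c i * c (l + 1) \<le> c l * c (i + 1)"
      using that less c_pos by (intro log_concave_ratio_antimono) (auto simp: i_def l_def)
    moreover have "N - k = i + 1" "N - j = l + 1"
      using that False by (auto simp: i_def l_def N_def)
    ultimately show ?thesis
      using that False by (simp add: a_def b_def i_def l_def mult_ac)
  next
    case True
    then show ?thesis using that c_pos[of "N-k"] c_pos[of "n-j"] by (simp add: a_def b_def)
  qed
  have nonneg: "(a k * b j - a j * b k) * m k j \<ge> 0" if "j \<le> N" "k \<le> N" for j k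
  proof (cases j k rule: linorder_cases)
    case less
    then show ?thesis using m_nonneg[of j k] ab_nonneg[of j k] that by simp
  next
    case greater
    then have "m k j = - m j k" by (simp add: m_def)
    then show ?thesis using m_nonneg[of k j] ab_nonneg[of k j] that greater
      by (simp add: mult_nonpos_nonneg)
  qed simp
  define S where "S = (\<Sum>k\<le>N. \<Sum>j\<le>N. a k * b j * m k j)"
  \<comment> \<open>Swapping the indices flips the sign of \<open>m\<close>, so adding both forms of
    \<open>S\<close> yields products of two minors that never have opposite signs.\<close>
  have "S = (\<Sum>k\<le>N. \<Sum>j\<le>N. a j * b k * m j k)"
    unfolding S_def by (rule sum.swap)
  also have "\<dots> = (\<Sum>k\<le>N. \<Sum>j\<le>N. - (a j * b k * m k j))"
    by (intro sum.cong) (auto simp: m_def algebra_simps)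
  finally have "2 * S = (\<Sum>k\<le>N. \<Sum>j\<le>N. (a k * b j - a j * b k) * m k j)"
    by (simp add: S_def sum_subtractf sum_negf left_diff_distrib)
  also have "\<dots> \<ge> 0" by (intro sum_nonneg nonneg) auto
  finally have S_nonneg: "S \<ge> 0" by simp
  have "S = (\<Sum>k\<le>N. \<Sum>j\<le>N. (a k * X k) * (b j * X (j + 1)) - (a k * X (k + 1)) * (b j * X j))"
    unfolding S_def m_def by (intro sum.cong) (auto simp: algebra_simps)
  also have "\<dots> = (\<Sum>k\<le>N. a k * X k) * (\<Sum>j\<le>N. b j * X (j + 1))
      - (\<Sum>k\<le>N. a k * X (k + 1)) * (\<Sum>j\<le>N. b j * X j)"
    by (simp add: sum_product sum_subtractf)
  also have "(\<Sum>k\<le>N. a k * X (k + 1)) = real (N + 1) * c (N + 1)"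
    using c_rec[of N] by (simp add: a_def mult.commute)
  \<comment> \<open>The term \<open>k = 0\<close>, equal to \<open>c M\<close> because
    \<open>X 0 = 1\<close>, raises the factor \<open>M\<close> of the recurrence to
    \<open>M + 1\<close>.\<close>
  also have ax: "(\<Sum>k\<le>M. c (M - k) * X k) = real (M + 1) * c M" for M
  proof (cases M)
    case (Suc M')
    then show ?thesis
      using c_rec[of M'] by (simp add: sum.atMost_Suc_shift X_0 mult.commute algebra_simps del: sum.atMost_Suc)
  qed (simp add: X_0)
  have "(\<Sum>k\<le>N. a k * X k) = real (N + 1) * c N"
    using ax[of N] by (simp add: a_def)
  also have "(\<Sum>j\<le>N. b j * X (j + 1)) = real N * c N"
    using c_rec[of n] by (simp add: b_def N_def mult.commute)
  also have "(\<Sum>j\<le>N. b j * X j) = real N * c n"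
    using ax[of n] by (simp add: b_def N_def)
  finally have "S = real (N + 1) * real N * ((c N)\<^sup>2 - c n * c (N + 1))"
    by (simp add: algebra_simps power2_eq_square)
  moreover have "real (N + 1) * real N > 0"
    unfolding N_def by (intro mult_pos_pos) auto
  ultimately have "(c N)\<^sup>2 - c n * c (N + 1) \<ge> 0"
    using S_nonneg by (metis mult.commute zero_le_mult_iff not_less)
  then show ?case by (simp add: N_def)
qed

lemma c_ratio_mono: "i \<le> j \<Longrightarrow> c i * c (j + 1) \<le> c j * c (i + 1)"
  by (intro log_concave_ratio_antimono c_pos c_log_concave)

text \<open>This is log-convexity of \<open>n! * c n\<close>. In the recurrence for
  \<open>c (n + 1)\<close>, multiplied by \<open>c (n + 1)\<close>, log-concavity shifts every
  product; adding one positive term completes the recurrence for \<open>c (n + 2)\<close>,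
  multiplied by \<open>c n\<close>.\<close>

lemma c_fact_log_convex: "real (n + 1) * (c (n + 1))\<^sup>2 \<le> real (n + 2) * (c n * c (n + 2))"
proof -
  have "real (n + 1) * c (n + 1) * c (n + 1) = (\<Sum>k\<le>n. X (Suc k) * c (n - k)) * c (n + 1)"
    using c_rec[of n] by simp
  also have "\<dots> = (\<Sum>k\<le>n. X (Suc k) * (c (n - k) * c (n + 1)))"
    by (simp add: sum_distrib_right mult.assoc)
  also have "\<dots> \<le> (\<Sum>k\<le>n. X (Suc k) * (c (n + 1 - k) * c n))"
  proof (intro sum_mono mult_left_mono)
    fix k assume "k \<in> {..n}"
    then show "c (n - k) * c (n + 1) \<le> c (n + 1 - k) * c n"
      using c_ratio_mono[of "n - k" n] by (simp add: mult_ac Suc_diff_le)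
  qed (use X_pos less_imp_le in auto)
  also have "\<dots> \<le> (\<Sum>k\<le>n+1. X (Suc k) * (c (n + 1 - k) * c n))"
    using X_pos c_pos by (simp add: less_imp_le)
  also have "\<dots> = (\<Sum>k\<le>n+1. X (Suc k) * c (n + 1 - k)) * c n"
    by (simp add: sum_distrib_right mult.assoc del: sum.atMost_Suc)
  also have "\<dots> = real (n + 2) * c (n + 2) * c n"
    using c_rec[of "n+1"] by simp
  finally show ?thesis by (simp add: power2_eq_square mult_ac)
qed

section \<open>Ratios of consecutive coefficients\<close>

definition \<rho> :: "nat \<Rightarrow> real" where "\<rho> n = c (n - 1) / c n"

lemma \<rho>_mono: "1 \<le> i \<Longrightarrow> i \<le> j \<Longrightarrow> \<rho> i \<le> \<rho> j"
  using c_ratio_mono[of "i-1" "j-1"] c_pos[of i] c_pos[of j] by (simp add: \<rho>_def field_simps)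

text \<open>For positive \<open>j\<close>, \<open>\<rho> j / j\<close> is the ratio of consecutive
  terms of \<open>n! * c n\<close>, so this is log-convexity of that sequence.\<close>

lemma \<rho>_div_antimono:
  assumes "1 \<le> i" "i \<le> j"
  shows "\<rho> j / real j \<le> \<rho> i / real i"
  using assms(2)
proof (induction j rule: dec_induct)
  case (step j)
  have "\<rho> (Suc j) / real (Suc j) \<le> \<rho> j / real j"
    using c_fact_log_convex[of "j-1"] step.hyps assms(1) c_pos[of "Suc j"] c_pos[of j]
      add_pos_nonneg[of "c (Suc j)" "real j * c (Suc j)"]
    by (simp add: \<rho>_def field_simps power2_eq_square)
  then show ?case using step by linarith
qed simp

lemma \<rho>_pos: "\<rho> n > 0"
  using c_pos by (simp add: \<rho>_def)

text \<open>The quotient \<open>c (n - k) / c n\<close> telescopes to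
  \<open>\<rho> n * \<rho> (n - 1) * ... * \<rho> (n - k + 1)\<close>, where no factor exceeds the
  first.\<close>

lemma c_diff_upper: "k \<le> n \<Longrightarrow> c (n - k) \<le> \<rho> n ^ k * c n"
proof (induction k)
  case (Suc k)
  have "c (n - Suc k) = \<rho> (n - k) * c (n - k)"
    using c_pos[of "n-k"] by (simp add: \<rho>_def)
  also have "\<dots> \<le> \<rho> n * (\<rho> n ^ k * c n)"
    using Suc c_pos \<rho>_pos by (intro mult_mono \<rho>_mono) (auto simp: less_imp_le)
  finally show ?case by (simp add: mult_ac)
qed simp

text \<open>In the same product \<open>\<rho> (n - i)\<close> is at least
  \<open>(n - i) / n * \<rho> n\<close>. The separate bound \<open>l\<close> keeps the factor
  \<open>(n - l) / n\<close> constant along the induction on \<open>k\<close>.\<close>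

lemma c_diff_lower:
  "k \<le> l \<Longrightarrow> k \<le> n \<Longrightarrow> n > 0 \<Longrightarrow> (real (n - l) / real n) ^ k * \<rho> n ^ k * c n \<le> c (n - k)"
proof (induction k)
  case (Suc k)
  have "real (n - l) / real n * \<rho> n \<le> real (n - k) / real n * \<rho> n"
    using Suc \<rho>_pos[of n] by (intro mult_right_mono divide_right_mono) auto
  also have "\<dots> \<le> \<rho> (n - k)"
    using \<rho>_div_antimono[of "n-k" n] Suc by (simp add: field_simps)
  finally have "(real (n - l) / real n * \<rho> n) * ((real (n - l) / real n) ^ k * \<rho> n ^ k * c n)
      \<le> \<rho> (n - k) * c (n - k)"
    using Suc c_pos \<rho>_pos by (intro mult_mono) (auto simp: less_imp_le)
  also have "\<dots> = c (n - Suc k)"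
    using c_pos[of "n-k"] by (simp add: \<rho>_def)
  finally show ?case by (simp add: mult_ac)
qed simp

end

subsection \<open>Counting cluster graphs\<close>

definition pairs :: "nat set \<Rightarrow> nat set set" where
  "pairs V = {e. e \<subseteq> V \<and> card e = 2}"

text \<open>Transitivity of adjacency between distinct vertices replaces completeness of components.
  The vertex set is arbitrary because the recursion deletes cliques.\<close>

definition cluster_edge_sets :: "nat set \<Rightarrow> nat set set set" where
  "cluster_edge_sets V = {E. E \<subseteq> pairs V \<and>
     (\<forall>u v w. adjacent E u v \<longrightarrow> adjacent E v w \<longrightarrow> u \<noteq> w \<longrightarrow> adjacent E u w)}"

definition cluster_weight_sum :: "real \<Rightarrow> nat set \<Rightarrow> real" where
  "cluster_weight_sum r V = (\<Sum>E\<in>cluster_edge_sets V. r ^ card E)"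

lemma adjacent_sym: "adjacent E u v \<Longrightarrow> adjacent E v u"
  by (auto simp: adjacent_def insert_commute)

lemma pairs_iff: "{u, v} \<in> pairs V \<longleftrightarrow> u \<in> V \<and> v \<in> V \<and> u \<noteq> v"
  by (auto simp: pairs_def card_2_iff doubleton_eq_iff)

lemma adjacent_in: "E \<subseteq> pairs V \<Longrightarrow> adjacent E u v \<Longrightarrow> u \<in> V \<and> v \<in> V"
  unfolding adjacent_def using pairs_iff by blast

lemma pairs_atLeastAtMost: "pairs {1..n} = possible_edges n"
  by (simp add: pairs_def possible_edges_def)

lemma finite_pairs: "finite V \<Longrightarrow> finite (pairs V)"
  by (rule finite_subset[of _ "Pow V"]) (auto simp: pairs_def)

lemma card_pairs: "finite V \<Longrightarrow> card (pairs V) = card V choose 2"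
  by (simp add: pairs_def n_subsets)

lemma finite_cluster_edge_sets: "finite V \<Longrightarrow> finite (cluster_edge_sets V)"
  by (rule finite_subset[of _ "Pow (pairs V)"]) (auto simp: cluster_edge_sets_def finite_pairs)

lemma cluster_edge_sets_empty: "cluster_edge_sets {} = {{}}"
  by (auto simp: cluster_edge_sets_def pairs_def adjacent_def)

text \<open>The ends of a path of length two lie in one component. Conversely, transitivity
  contracts every path, so reachability is equality or adjacency.\<close>

lemma cluster_graph_iff: "cluster_graph n E \<longleftrightarrow> E \<in> cluster_edge_sets {1..n}"
proof
  assume C: "cluster_graph n E"
  then have E: "E \<subseteq> pairs {1..n}" unfolding cluster_graph_def pairs_atLeastAtMost by blast
  have "adjacent E u w" if uv: "adjacent E u v" and vw: "adjacent E v w" and "u \<noteq> w" for u v w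
  proof -
    have "{x. (adjacent E)\<^sup>*\<^sup>* u x} \<in> components n E"
      using adjacent_in[OF E uv] by (auto simp: components_def)
    moreover have "(adjacent E)\<^sup>*\<^sup>* u w" using uv vw by (meson r_into_rtranclp rtranclp.rtrancl_into_rtrancl)
    ultimately show ?thesis using C \<open>u \<noteq> w\<close> by (auto simp: cluster_graph_def complete_on_def)
  qed
  then show "E \<in> cluster_edge_sets {1..n}" using E by (auto simp: cluster_edge_sets_def)
next
  assume "E \<in> cluster_edge_sets {1..n}"
  then have E: "E \<subseteq> pairs {1..n}"
    and trans: "\<And>u v w. adjacent E u v \<Longrightarrow> adjacent E v w \<Longrightarrow> u \<noteq> w \<Longrightarrow> adjacent E u w"
    by (auto simp: cluster_edge_sets_def)
  have reach: "u = v \<or> adjacent E v u" if "(adjacent E)\<^sup>*\<^sup>* v u" for u v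
    using that by (induction rule: rtranclp_induct) (auto intro: trans)
  have "complete_on E {u. (adjacent E)\<^sup>*\<^sup>* v u}" for v
    unfolding complete_on_def using reach trans adjacent_sym by (metis mem_Collect_eq)
  then show "cluster_graph n E"
    using E unfolding cluster_graph_def components_def pairs_atLeastAtMost by blast
qed

text \<open>The component of \<open>v\<close> is the clique on \<open>A\<close>; no edge leaves it,
  and the rest is a free choice of cluster graph on \<open>V - A\<close>.\<close>

lemma cluster_edge_sets_neighbourhood:
  assumes v: "v \<in> V" and S: "S \<subseteq> V - {v}"
  defines "A \<equiv> insert v S"
  shows "{E \<in> cluster_edge_sets V. {u. adjacent E v u} = S}
    = (\<lambda>E. E \<union> pairs A) ` cluster_edge_sets (V - A)" (is "?L = ?R")
proof (intro equalityI subsetI)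
  fix E assume "E \<in> ?L"
  then have E: "E \<subseteq> pairs V" and nb: "{u. adjacent E v u} = S"
    and trans: "\<And>u v w. adjacent E u v \<Longrightarrow> adjacent E v w \<Longrightarrow> u \<noteq> w \<Longrightarrow> adjacent E u w"
    by (auto simp: cluster_edge_sets_def)
  have in_A: "u \<in> A \<longleftrightarrow> u = v \<or> adjacent E v u" for u
    using nb by (auto simp: A_def)
  have closed: "w \<in> A" if "u \<in> A" "adjacent E u w" for u w
    using that trans adjacent_sym unfolding in_A by metis
  have clique: "adjacent E u w" if "u \<in> A" "w \<in> A" "u \<noteq> w" for u w
    using that trans adjacent_sym unfolding in_A by metis
  define E' where "E' = E - pairs A"
  have adj': "adjacent E' u w \<longleftrightarrow> adjacent E u w \<and> u \<notin> A" for u w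
    using closed[of u w] closed[of w u] pairs_iff[of u w A] adjacent_sym[of E u w]
    by (auto simp: E'_def adjacent_def)
  have sub: "E' \<subseteq> pairs (V - A)"
  proof
    fix e assume e: "e \<in> E'"
    then have "e \<in> pairs V" using E by (auto simp: E'_def)
    then obtain u w where uw: "e = {u, w}" "u \<noteq> w"
      by (auto simp: pairs_def card_2_iff)
    then have "adjacent E' u w" "adjacent E' w u"
      using e by (auto simp: adjacent_def insert_commute)
    then show "e \<in> pairs (V - A)"
      using uw adj' adjacent_in[OF E] by (auto simp: pairs_iff)
  qed
  have "pairs A \<subseteq> E"
  proof
    fix e assume "e \<in> pairs A"
    then obtain u w where uw: "e = {u, w}" "u \<noteq> w" "u \<in> A" "w \<in> A"
      by (auto simp: pairs_def card_2_iff)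
    then show "e \<in> E" using clique[of u w] by (auto simp: adjacent_def)
  qed
  then have "E = E' \<union> pairs A" by (auto simp: E'_def)
  moreover have "E' \<in> cluster_edge_sets (V - A)"
    unfolding cluster_edge_sets_def using sub trans adj' by blast
  ultimately show "E \<in> ?R" by blast
next
  fix E assume "E \<in> ?R"
  then obtain E' where E': "E' \<in> cluster_edge_sets (V - A)" and E: "E = E' \<union> pairs A" by blast
  from E' have sub: "E' \<subseteq> pairs (V - A)"
    and trans: "\<And>u v w. adjacent E' u v \<Longrightarrow> adjacent E' v w \<Longrightarrow> u \<noteq> w \<Longrightarrow> adjacent E' u w"
    by (auto simp: cluster_edge_sets_def)
  have adj: "adjacent E u w \<longleftrightarrow> adjacent E' u w \<or> (u \<noteq> w \<and> u \<in> A \<and> w \<in> A)" for u w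
    by (auto simp: E adjacent_def pairs_iff)
  have out: "u \<notin> A \<and> w \<notin> A" if "adjacent E' u w" for u w
    using adjacent_in[OF sub that] by auto
  have "A \<subseteq> V" using v S by (auto simp: A_def)
  then have "E \<subseteq> pairs V" using sub unfolding E pairs_def by blast
  moreover have "{u. adjacent E v u} = S"
    unfolding adj using out[of v] S by (auto simp: A_def)
  moreover have "adjacent E u w" if "adjacent E u x" "adjacent E x w" "u \<noteq> w" for u x w
    using that trans out unfolding adj by metis
  ultimately show "E \<in> ?L" by (auto simp: cluster_edge_sets_def)
qed

lemma sum_cluster_edge_sets_neighbourhood:
  assumes v: "v \<in> V" and S: "S \<subseteq> V - {v}" and V: "finite V"
  shows "(\<Sum>E | E \<in> cluster_edge_sets V \<and> {u. adjacent E v u} = S. r ^ card E)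
    = r ^ (Suc (card S) choose 2) * cluster_weight_sum r (V - insert v S)"
proof -
  define A where "A = insert v S"
  have fin: "finite A" "finite S" using S V by (auto simp: A_def intro: finite_subset)
  have cardA: "card A = Suc (card S)" using S fin by (subst A_def, subst card_insert_disjoint) auto
  have disj: "E \<inter> pairs A = {}" if "E \<in> cluster_edge_sets (V - A)" for E
    using that by (fastforce simp: cluster_edge_sets_def pairs_def card_2_iff)
  have "inj_on (\<lambda>E. E \<union> pairs A) (cluster_edge_sets (V - A))"
    using disj by (intro inj_onI) blast
  then have "(\<Sum>E | E \<in> cluster_edge_sets V \<and> {u. adjacent E v u} = S. r ^ card E)
    = (\<Sum>E\<in>cluster_edge_sets (V - A). r ^ card (E \<union> pairs A))"
    using cluster_edge_sets_neighbourhood[OF v S] by (simp add: sum.reindex flip: A_def)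
  also have "\<dots> = (\<Sum>E\<in>cluster_edge_sets (V - A). r ^ (Suc (card S) choose 2) * r ^ card E)"
  proof (intro sum.cong refl)
    fix E assume E: "E \<in> cluster_edge_sets (V - A)"
    then have "finite E"
      using finite_pairs[of "V - A"] V by (auto simp: cluster_edge_sets_def intro: finite_subset)
    then show "r ^ card (E \<union> pairs A) = r ^ (Suc (card S) choose 2) * r ^ card E"
      using disj[OF E] fin by (simp add: card_Un_disjoint finite_pairs card_pairs cardA power_add)
  qed
  finally show ?thesis by (simp add: cluster_weight_sum_def sum_distrib_left A_def)
qed

text \<open>At \<open>k = 0\<close> both truncated \<open>k - 1\<close> and \<open>0 choose 2\<close> vanish, so the value there is \<open>1\<close>.\<close>

definition block_weight :: "real \<Rightarrow> nat \<Rightarrow> real" where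
  "block_weight r k = r ^ (k choose 2) / fact (k - 1)"

text \<open>Introduced through its recurrence; \<open>cluster_weight_sum_eq\<close> identifies it
  with the weight sum divided by the factorial.\<close>

fun cluster_coeff :: "real \<Rightarrow> nat \<Rightarrow> real" where
  "cluster_coeff r n = (if n = 0 then 1
     else (\<Sum>k<n. block_weight r (Suc k) * cluster_coeff r (n - Suc k)) / real n)"

declare cluster_coeff.simps [simp del]

lemma cluster_coeff_0 [simp]: "cluster_coeff r 0 = 1"
  by (simp add: cluster_coeff.simps)

lemma cluster_coeff_rec:
  "real (Suc n) * cluster_coeff r (Suc n) = (\<Sum>k\<le>n. block_weight r (Suc k) * cluster_coeff r (n - k))"
  by (simp add: cluster_coeff.simps[of r "Suc n"] lessThan_Suc_atMost field_simps)

text \<open>The quotient of consecutive ratios of \<open>r ^ (k choose 2)\<close> is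
  \<open>r \<le> 1\<close>, and factorials are log-convex. At \<open>k = 0\<close>, with the
  convention \<open>block_weight r 0 = 1\<close>, log-concavity reads
  \<open>r \<le> 1\<close>.\<close>

lemma log_concave_exponential_cluster:
  assumes "0 < r" "r \<le> 1"
  shows "log_concave_exponential (block_weight r) (cluster_coeff r)"
proof
  fix k :: nat
  show "block_weight r k * block_weight r (k + 2) \<le> (block_weight r (k + 1))\<^sup>2"
  proof (cases k)
    case 0
    then show ?thesis using assms by (simp add: block_weight_def numeral_2_eq_2)
  next
    case (Suc m)
    define a where "a = k choose 2"
    have 1: "(k + 1) choose 2 = a + k" "(k + 2) choose 2 = a + k + (k + 1)"
      by (simp_all add: a_def numeral_2_eq_2)
    have "r ^ a * r ^ (a + k + (k + 1)) = (r ^ (a + k))\<^sup>2 * r"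
      by (simp add: power2_eq_square power_add mult_ac)
    also have "\<dots> \<le> (r ^ (a + k))\<^sup>2"
      using assms by (intro mult_left_le) auto
    finally have 2: "r ^ a * r ^ (a + k + (k + 1)) \<le> (r ^ (a + k))\<^sup>2" .
    have "(fact k :: real)\<^sup>2 \<le> fact (k - 1) * fact (k + 1)"
      by (simp add: Suc power2_eq_square algebra_simps)
    with 2 have "(r ^ a * r ^ (a + k + (k + 1))) / (fact (k - 1) * fact (k + 1))
       \<le> (r ^ (a + k))\<^sup>2 / (fact k)\<^sup>2"
      using assms by (intro frac_le) auto
    then show ?thesis
      unfolding block_weight_def 1 a_def[symmetric] by (simp add: power_divide)
  qed
next
  show "block_weight r 0 = 1" by (simp add: block_weight_def binomial_eq_0)
  show "block_weight r k > 0" for k using assms by (simp add: block_weight_def)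
qed (simp_all only: cluster_coeff_0 cluster_coeff_rec zero_less_one)

lemma neighbours_subset:
  assumes "E \<in> cluster_edge_sets V"
  shows "{u. adjacent E v u} \<subseteq> V - {v}"
  using assms adjacent_in[of E V v] by (auto simp: cluster_edge_sets_def adjacent_def)

text \<open>Grouping by the neighbourhood of \<open>v\<close> gives \<open>N choose k\<close> equal
  terms, each the weight of a clique times the sum over the other \<open>N - k\<close> vertices. The
  value of that sum is assumed, so that the computation can be used in the induction establishing
  it.\<close>

lemma sum_degree_aux:
  assumes v: "v \<in> V" and V: "finite V" "card V = Suc N" and k: "k \<le> N"
    and IH: "\<And>W. W \<subseteq> V \<Longrightarrow> card W = N - k \<Longrightarrow> cluster_weight_sum r W = fact (N - k) * cluster_coeff r (N - k)"
  shows "(\<Sum>E | E \<in> cluster_edge_sets V \<and> vertex_degree E v = k. r ^ card E)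
    = fact N * block_weight r (Suc k) * cluster_coeff r (N - k)"
proof -
  define T where "T = {S. S \<subseteq> V - {v} \<and> card S = k}"
  have finT: "finite T" using V by (auto simp: T_def)
  have cardT: "card T = N choose k" using V v by (simp add: T_def n_subsets)
  have "(\<Sum>E | E \<in> cluster_edge_sets V \<and> vertex_degree E v = k. r ^ card E)
    = (\<Sum>S\<in>T. \<Sum>E | E \<in> {E. E \<in> cluster_edge_sets V \<and> vertex_degree E v = k} \<and> {u. adjacent E v u} = S. r ^ card E)"
    using V v neighbours_subset[of _ V v] finT
    by (intro sum.group[symmetric]) (auto simp: T_def vertex_degree_def finite_cluster_edge_sets)
  also have "\<dots> = (\<Sum>S\<in>T. r ^ (Suc k choose 2) * (fact (N - k) * cluster_coeff r (N - k)))"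
  proof (intro sum.cong refl)
    fix S assume S: "S \<in> T"
    then have S': "S \<subseteq> V - {v}" "card S = k" "finite S"
      using V by (auto simp: T_def intro: finite_subset)
    have card: "card (V - insert v S) = N - k"
      using S' v V by (subst card_Diff_subset) (auto simp: card_insert_if)
    have "(\<Sum>E | E \<in> {E. E \<in> cluster_edge_sets V \<and> vertex_degree E v = k} \<and> {u. adjacent E v u} = S. r ^ card E)
      = (\<Sum>E | E \<in> cluster_edge_sets V \<and> {u. adjacent E v u} = S. r ^ card E)"
      using S' by (intro sum.cong) (auto simp: vertex_degree_def)
    also have "\<dots> = r ^ (Suc k choose 2) * cluster_weight_sum r (V - insert v S)"
      using sum_cluster_edge_sets_neighbourhood[OF v S'(1) V(1)] S'(2) by simp
    also have "\<dots> = r ^ (Suc k choose 2) * (fact (N - k) * cluster_coeff r (N - k))"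
      using IH[OF _ card] by simp
    finally show "(\<Sum>E | E \<in> {E. E \<in> cluster_edge_sets V \<and> vertex_degree E v = k} \<and> {u. adjacent E v u} = S. r ^ card E)
      = r ^ (Suc k choose 2) * (fact (N - k) * cluster_coeff r (N - k))" .
  qed
  also have "\<dots> = real (N choose k) * (r ^ (Suc k choose 2) * (fact (N - k) * cluster_coeff r (N - k)))"
    by (simp add: cardT)
  also have "\<dots> = fact N * block_weight r (Suc k) * cluster_coeff r (N - k)"
    using k by (simp add: binomial_fact block_weight_def)
  finally show ?thesis .
qed

text \<open>Sorting the graphs by the degree of one vertex reproduces the recurrence of
  \<open>cluster_coeff\<close>, multiplied by \<open>fact N\<close>.\<close>

lemma cluster_weight_sum_eq:
  "finite V \<Longrightarrow> cluster_weight_sum r V = fact (card V) * cluster_coeff r (card V)"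
proof (induction "card V" arbitrary: V rule: less_induct)
  case less
  show ?case
  proof (cases "card V")
    case 0
    then show ?thesis using less
      by (simp add: cluster_weight_sum_def cluster_edge_sets_empty)
  next
    case (Suc N)
    then obtain v where v: "v \<in> V" by fastforce
    have "cluster_weight_sum r V
      = (\<Sum>k\<in>{..N}. \<Sum>E | E \<in> cluster_edge_sets V \<and> vertex_degree E v = k. r ^ card E)"
      unfolding cluster_weight_sum_def
    proof (intro sum.group[symmetric] finite_cluster_edge_sets less.prems)
      show "(\<lambda>E. vertex_degree E v) ` cluster_edge_sets V \<subseteq> {..N}"
        using card_mono[OF _ neighbours_subset[of _ V v]] less.prems v Suc
        by (auto simp: vertex_degree_def)
    qed simp
    also have "\<dots> = (\<Sum>k\<le>N. fact N * block_weight r (Suc k) * cluster_coeff r (N - k))"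
    proof (intro sum.cong refl sum_degree_aux)
      fix k W assume W: "k \<in> {..N}" "W \<subseteq> V" "card W = N - k"
      moreover have "finite W" using W(2) less.prems by (rule finite_subset)
      ultimately show "cluster_weight_sum r W = fact (N - k) * cluster_coeff r (N - k)"
        using less.hyps[of W] Suc by simp
    qed (use less.prems v Suc in auto)
    also have "\<dots> = fact (Suc N) * cluster_coeff r (Suc N)"
      using cluster_coeff_rec[of N r] by (simp add: sum_distrib_left mult_ac)
    finally show ?thesis using Suc by simp
  qed
qed

lemma sum_degree:
  assumes "v \<in> V" "finite V" "card V = Suc N" "k \<le> N"
  shows "(\<Sum>E | E \<in> cluster_edge_sets V \<and> vertex_degree E v = k. r ^ card E)
    = fact N * block_weight r (Suc k) * cluster_coeff r (N - k)"
proof (intro sum_degree_aux)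
  fix W assume W: "W \<subseteq> V" "card W = N - k"
  have "finite W" using W(1) assms(2) by (rule finite_subset)
  then show "cluster_weight_sum r W = fact (N - k) * cluster_coeff r (N - k)"
    using cluster_weight_sum_eq[of W r] W by simp
qed (use assms in auto)

section \<open>Laws of the random graph and of the degree\<close>

lemma pmf_erdos_renyi:
  assumes p: "0 < p" "p < 1" and E: "E \<subseteq> possible_edges n"
  shows "pmf (erdos_renyi n p) E = (1 - p) ^ card (possible_edges n) * (p / (1 - p)) ^ card E"
proof -
  let ?A = "possible_edges n"
  let ?M = "Pi_pmf ?A False (\<lambda>_. bernoulli_pmf p)"
  let ?g = "\<lambda>f. {e \<in> ?A. f e}"
  let ?f = "\<lambda>e. e \<in> E"
  have fin: "finite ?A" "finite E" using finite_possible_edges E by (auto intro: finite_subset)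
  have set: "set_pmf ?M = PiE_dflt ?A False (\<lambda>_. UNIV)"
    using p by (simp add: set_Pi_pmf fin)
  have "inj_on ?g (set_pmf ?M)"
    unfolding set by (intro inj_onI ext) (auto simp: PiE_dflt_def)
  moreover have "?f \<in> set_pmf ?M" unfolding set using E by (auto simp: PiE_dflt_def)
  ultimately have "pmf (map_pmf ?g ?M) (?g ?f) = pmf ?M ?f" by (rule pmf_map_inj)
  moreover have "?g ?f = E" using E by auto
  ultimately have "pmf (erdos_renyi n p) E = pmf ?M ?f" by (simp add: erdos_renyi_def)
  also have "\<dots> = (\<Prod>e\<in>?A. pmf (bernoulli_pmf p) (e \<in> E))"
    using E fin by (intro pmf_Pi') auto
  \<comment> \<open>Taking out \<open>1 - p\<close> for every pair leaves the weight
    \<open>p / (1 - p)\<close> per edge; the common power cancels on conditioning.\<close>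
  also have "\<dots> = (\<Prod>e\<in>?A. (1 - p) * (if e \<in> E then p / (1 - p) else 1))"
    using p by (intro prod.cong) auto
  also have "\<dots> = (1 - p) ^ card ?A * (p / (1 - p)) ^ card (?A \<inter> E)"
    using fin by (simp add: prod.distrib prod.If_cases)
  finally show ?thesis using E by (simp add: Int_absorb1)
qed

lemma pmf_random_cluster_graph:
  assumes p: "0 < p" "p < 1"
  shows "pmf (random_cluster_graph n p) E = (if cluster_graph n E
    then (p / (1 - p)) ^ card E / (fact n * cluster_coeff (p / (1 - p)) n) else 0)"
proof -
  let ?q = "(1 - p) ^ card (possible_edges n)" and ?r = "p / (1 - p)"
  have eq: "{E. cluster_graph n E} = cluster_edge_sets {1..n}"
    by (auto simp: cluster_graph_iff)
  have pmf_eq: "pmf (erdos_renyi n p) E = ?q * ?r ^ card E" if "cluster_graph n E" for E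
    using that p by (intro pmf_erdos_renyi) (auto simp: cluster_graph_def)
  have "measure (erdos_renyi n p) {E. cluster_graph n E} = (\<Sum>E | cluster_graph n E. ?q * ?r ^ card E)"
    by (subst measure_measure_pmf_finite) (auto simp: eq finite_cluster_edge_sets pmf_eq cluster_graph_iff)
  also have "\<dots> = ?q * (fact n * cluster_coeff ?r n)"
    using cluster_weight_sum_eq[of "{1..n}" ?r]
    by (simp add: eq cluster_weight_sum_def flip: sum_distrib_left)
  finally show ?thesis
    unfolding random_cluster_graph_def pmf_cond[OF cluster_graph_possible[OF p]]
    using p by (simp add: pmf_eq)
qed

text \<open>By \<open>sum_degree\<close> all vertices contribute equally, so averaging over them
  leaves one term, with \<open>fact N / fact n = 1 / n\<close>.\<close>

lemma pmf_random_degree: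
  assumes p: "0 < p" "p < 1" and k: "k < n"
  defines "r \<equiv> p / (1 - p)"
  shows "pmf (random_degree n p) k
    = block_weight r (Suc k) * cluster_coeff r (n - Suc k) / (real n * cluster_coeff r n)"
proof -
  obtain N where N: "n = Suc N" using k by (cases n) auto
  let ?R = "random_cluster_graph n p" and ?U = "pmf_of_set {1..n}"
  let ?C = "cluster_edge_sets {1..n}"
  let ?D = "{(E, v). E \<in> ?C \<and> v \<in> {1..n} \<and> vertex_degree E v = k}"
  have finC: "finite ?C" by (simp add: finite_cluster_edge_sets)
  have finD: "finite ?D"
    using finC by (intro finite_subset[of ?D "?C \<times> {1..n}"]) auto
  have setR: "set_pmf ?R \<subseteq> ?C"
    using cluster_graph_possible[OF p] by (auto simp: random_cluster_graph_def cluster_graph_iff)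
  have "pmf (random_degree n p) k
    = measure (pair_pmf ?R ?U) ((\<lambda>(E, v). vertex_degree E v) -` {k})"
    by (simp add: random_degree_def pmf_map)
  \<comment> \<open>Discarding a null set makes the event finite, so its probability becomes a
    finite sum.\<close>
  also have "\<dots> = measure (pair_pmf ?R ?U) ?D"
    using k setR by (intro measure_pmf.finite_measure_eq_AE) (auto simp: AE_measure_pmf_iff)
  also have "\<dots> = (\<Sum>(E, v)\<in>?D. pmf ?R E * pmf ?U v)"
    using finD by (subst measure_measure_pmf_finite) (auto intro!: sum.cong simp: pmf_pair)
  also have "\<dots> = (\<Sum>(v, E)\<in>(SIGMA v:{1..n}. {E. E \<in> ?C \<and> vertex_degree E v = k}).
      pmf ?R E * pmf ?U v)"
    by (rule sum.reindex_bij_witness[of _ prod.swap prod.swap]) auto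
  also have "\<dots> = (\<Sum>v\<in>{1..n}. \<Sum>E | E \<in> ?C \<and> vertex_degree E v = k. pmf ?R E * pmf ?U v)"
    using finC by (subst sum.Sigma) auto
  also have "\<dots> = (\<Sum>v\<in>{1..n}. \<Sum>E | E \<in> ?C \<and> vertex_degree E v = k.
      r ^ card E / (fact n * cluster_coeff r n) / real n)"
    using k by (intro sum.cong refl) (simp add: pmf_random_cluster_graph[OF p] cluster_graph_iff r_def)
  also have "\<dots> = (\<Sum>v\<in>{1..n}. (\<Sum>E | E \<in> ?C \<and> vertex_degree E v = k. r ^ card E)
      / (fact n * cluster_coeff r n) / real n)"
    by (simp add: sum_divide_distrib)
  also have "\<dots> = (\<Sum>v\<in>{1..n}. (fact N * block_weight r (Suc k) * cluster_coeff r (N - k))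
      / (fact n * cluster_coeff r n) / real n)"
    using k N by (intro sum.cong refl, subst sum_degree) auto
  also have "\<dots> = block_weight r (Suc k) * cluster_coeff r (n - Suc k) / (real n * cluster_coeff r n)"
    using N by (simp add: divide_simps)
  finally show ?thesis .
qed

subsection \<open>Asymptotics\<close>

text \<open>This is the recurrence of \<open>cluster_coeff\<close> divided by its left-hand
  side.\<close>

lemma sum_pmf_random_degree:
  assumes p: "0 < p" "p < 1" and n: "0 < n" and c: "cluster_coeff (p / (1 - p)) n > 0"
  shows "(\<Sum>k<n. pmf (random_degree n p) k) = 1"
proof -
  obtain N where N: "n = Suc N" using n by (cases n) auto
  let ?r = "p / (1 - p)"
  have "(\<Sum>k<n. pmf (random_degree n p) k)
    = (\<Sum>k<n. block_weight ?r (Suc k) * cluster_coeff ?r (n - Suc k) / (real n * cluster_coeff ?r n))"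
    using p by (intro sum.cong) (auto simp: pmf_random_degree)
  also have "\<dots> = (\<Sum>k\<le>N. block_weight ?r (Suc k) * cluster_coeff ?r (N - k)) / (real n * cluster_coeff ?r n)"
    by (simp add: N lessThan_Suc_atMost flip: sum_divide_distrib)
  also have "\<dots> = 1"
    using c unfolding N cluster_coeff_rec[symmetric] by simp
  finally show ?thesis .
qed

definition cluster_ratio :: "real \<Rightarrow> nat \<Rightarrow> real" where
  "cluster_ratio r n = cluster_coeff r (n - 1) / cluster_coeff r n"

text \<open>The exact probability with
  \<open>cluster_coeff r (n - Suc k) / cluster_coeff r n\<close> replaced by a power of a single
  ratio. Degree \<open>k\<close> belongs to clique size \<open>Suc k\<close>.\<close>

definition degree_estimate :: "real \<Rightarrow> nat \<Rightarrow> nat \<Rightarrow> real" where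
  "degree_estimate r n k = block_weight r (Suc k) * cluster_ratio r n ^ Suc k / real n"

lemma cluster_positivity:
  assumes "0 < r" "r \<le> 1"
  shows cluster_coeff_pos: "cluster_coeff r n > 0" and cluster_ratio_pos: "cluster_ratio r n > 0"
    and block_weight_pos: "block_weight r n > 0"
proof -
  interpret log_concave_exponential "block_weight r" "cluster_coeff r"
    using assms by (rule log_concave_exponential_cluster)
  show "cluster_coeff r n > 0" "cluster_ratio r n > 0" "block_weight r n > 0"
    using c_pos \<rho>_pos X_pos by (auto simp: cluster_ratio_def \<rho>_def)
qed

text \<open>The bound \<open>p \<le> 1 / 2\<close> gives \<open>r \<le> 1\<close> and hence
  log-concavity. The upper estimate has no loss depending on \<open>k\<close>, as the sum over all
  degrees requires; the prefactor of the lower one tends to 1 for each fixed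
  \<open>k\<close>.\<close>

lemma pmf_random_degree_bounds:
  assumes p: "0 < p" "p \<le> 1 / 2" and k: "k < n"
  defines "r \<equiv> p / (1 - p)"
  shows "pmf (random_degree n p) k \<le> degree_estimate r n k"
    and "(real (n - Suc k) / real n) ^ Suc k * degree_estimate r n k \<le> pmf (random_degree n p) k"
proof -
  have r: "0 < r" "r \<le> 1" using p by (auto simp: r_def field_simps)
  interpret log_concave_exponential "block_weight r" "cluster_coeff r"
    using r by (rule log_concave_exponential_cluster)
  have rho: "\<rho> n = cluster_ratio r n" by (simp add: \<rho>_def cluster_ratio_def)
  have pmf: "pmf (random_degree n p) k
    = block_weight r (Suc k) * (cluster_coeff r (n - Suc k) / cluster_coeff r n) / real n"
    using p k by (simp add: pmf_random_degree r_def)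
  have "cluster_coeff r (n - Suc k) / cluster_coeff r n \<le> cluster_ratio r n ^ Suc k"
    using c_diff_upper[of "Suc k" n] k c_pos[of n] by (simp add: rho pos_divide_le_eq)
  then show "pmf (random_degree n p) k \<le> degree_estimate r n k"
    unfolding pmf degree_estimate_def using X_pos[of "Suc k"]
    by (intro divide_right_mono mult_left_mono) auto
  have "(real (n - Suc k) / real n) ^ Suc k * cluster_ratio r n ^ Suc k
      \<le> cluster_coeff r (n - Suc k) / cluster_coeff r n"
    using c_diff_lower[of "Suc k" "Suc k" n] k c_pos[of n] unfolding rho by (subst pos_le_divide_eq) auto
  then have "block_weight r (Suc k) * ((real (n - Suc k) / real n) ^ Suc k * cluster_ratio r n ^ Suc k) / real n
      \<le> pmf (random_degree n p) k"
    unfolding pmf using X_pos[of "Suc k"] by (intro divide_right_mono mult_left_mono) auto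
  then show "(real (n - Suc k) / real n) ^ Suc k * degree_estimate r n k \<le> pmf (random_degree n p) k"
    by (simp add: degree_estimate_def mult_ac)
qed

section \<open>Exponents to base \<open>n\<close>\<close>

lemma degree_estimate_eq_exp:
  assumes r: "0 < r" "r \<le> 1" and n: "n \<ge> 2"
  shows "degree_estimate r n k = exp (ln (real n) * (real (Suc k choose 2) * (ln r / ln (real n))
      + real (Suc k) * (ln (cluster_ratio r n) / ln (real n)) - 1)) / fact k"
proof -
  have L: "ln (real n) \<noteq> 0" using n by simp
  let ?x = "cluster_ratio r n"
  have x: "?x > 0" using r by (rule cluster_ratio_pos)
  have "ln (real n) * (real (Suc k choose 2) * (ln r / ln (real n))
      + real (Suc k) * (ln ?x / ln (real n)) - 1)
    = real (Suc k choose 2) * ln r + real (Suc k) * ln ?x - ln (real n)"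
    using L by (simp add: field_simps)
  also have "exp \<dots> = r ^ (Suc k choose 2) * ?x ^ Suc k / real n"
    using r x n by (simp only: exp_diff exp_add exp_of_nat_mult exp_ln)
  finally show ?thesis
    by (simp add: degree_estimate_def block_weight_def)
qed

lemma real_choose_2: "real (q choose 2) = real q * (real q - 1) / 2"
  by (induction q) (auto simp: numeral_2_eq_2 field_simps)

text \<open>The coefficient \<open>(2 * m - 1) / m^2\<close> makes the quadratic in \<open>q\<close>
  vanish at \<open>m\<close>; the product of its roots is \<open>m^2\<close>, so the root is
  double.\<close>

lemma exponent_identity:
  fixes m :: real
  assumes "m > 0"
  shows "real (q choose 2) * - (2 / m\<^sup>2) + real q * ((2 * m - 1) / m\<^sup>2) - 1 = - ((real q - m) / m)\<^sup>2"
  using assms by (simp add: real_choose_2 divide_simps) (simp add: algebra_simps power2_eq_square)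

text \<open>With \<open>D\<close> the distance from \<open>q\<close> to \<open>m\<close>, the square
  gains \<open>D^2 / m^2\<close> while the perturbation costs at most
  \<open>\<epsilon> * q^2\<close>. Since \<open>D \<ge> 1\<close>,
  \<open>q \<le> (m + 1) * D\<close>, and \<open>\<epsilon>\<close> is chosen so that the cost is at
  most half the gain, uniformly in \<open>q\<close>.\<close>

lemma exponent_bound:
  fixes m q :: nat and s t :: real
  defines "\<epsilon> \<equiv> 1 / (2 * (real m)\<^sup>2 * (real m + 1)\<^sup>2)"
  assumes m: "m > 0" and q: "q > 0" "q \<noteq> m"
    and s: "s \<le> - (2 / (real m)\<^sup>2) + \<epsilon>" and t: "t \<le> (2 * real m - 1) / (real m)\<^sup>2 + \<epsilon>"
  shows "real (q choose 2) * s + real q * t - 1 \<le> - (1 / (2 * (real m)\<^sup>2))"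
proof -
  define D where "D = \<bar>real q - real m\<bar>"
  have D: "D \<ge> 1" using q by (auto simp: D_def)
  have eps: "\<epsilon> \<ge> 0" by (simp add: \<epsilon>_def)
  have "real q \<le> real m + D" by (simp add: D_def)
  also have "real m \<le> real m * D" using D m by simp
  finally have "real q \<le> (real m + 1) * D" by (simp add: algebra_simps)
  then have "(real q)\<^sup>2 \<le> ((real m + 1) * D)\<^sup>2" by (intro power_mono) auto
  then have "\<epsilon> * (real q)\<^sup>2 \<le> \<epsilon> * ((real m + 1) * D)\<^sup>2" using eps by (rule mult_left_mono)
  also have "\<dots> = D\<^sup>2 / (2 * (real m)\<^sup>2)"
    by (simp add: \<epsilon>_def power_mult_distrib)
  finally have epsq: "\<epsilon> * (real q)\<^sup>2 \<le> D\<^sup>2 / (2 * (real m)\<^sup>2)" .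
  have "real (q choose 2) + real q \<le> (real q)\<^sup>2"
    using q by (simp add: real_choose_2 field_simps power2_eq_square)
  then have "\<epsilon> * (real (q choose 2) + real q) \<le> \<epsilon> * (real q)\<^sup>2" using eps by (rule mult_left_mono)
  note eps_le = this[THEN order_trans, OF epsq]
  have "real (q choose 2) * s + real q * t - 1
      \<le> real (q choose 2) * (- (2 / (real m)\<^sup>2) + \<epsilon>) + real q * ((2 * real m - 1) / (real m)\<^sup>2 + \<epsilon>) - 1"
    using s t by (intro diff_right_mono add_mono mult_left_mono) auto
  also have "\<dots> = - ((real q - real m) / real m)\<^sup>2 + \<epsilon> * (real (q choose 2) + real q)"
    using exponent_identity[of "real m" q] m by (simp add: algebra_simps)
  also have "((real q - real m) / real m)\<^sup>2 = D\<^sup>2 / (real m)\<^sup>2"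
    by (simp add: D_def power_divide)
  also have "- (D\<^sup>2 / (real m)\<^sup>2) + \<epsilon> * (real (q choose 2) + real q) \<le> - (D\<^sup>2 / (2 * (real m)\<^sup>2))"
    using eps_le by (simp add: field_simps)
  also have "\<dots> \<le> - (1 / (2 * (real m)\<^sup>2))"
    using D m by (simp add: divide_right_mono)
  finally show ?thesis .
qed

lemma sum_inverse_fact_le_exp: "(\<Sum>k<n. 1 / fact k) \<le> exp (1::real)"
proof -
  have "(\<Sum>k<n. 1 / fact k :: real) = (\<Sum>k<n. 1 ^ k /\<^sub>R fact k)"
    by (simp add: divide_inverse)
  also have "\<dots> \<le> exp 1"
    unfolding exp_def using summable_exp_generic[of "1::real"] by (intro sum_le_suminf) auto
  finally show ?thesis .
qed

lemma power_law_tendsto_0: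
  assumes "power_law a c" "c < 0"
  shows "a \<longlonglongrightarrow> 0"
proof -
  have L: "filterlim (\<lambda>n. ln (real n)) at_top sequentially" by real_asymp
  have "filterlim (\<lambda>n. ln (a n) / ln (real n) * ln (real n)) at_bot sequentially"
    using assms by (intro filterlim_tendsto_neg_mult_at_bot[OF _ _ L]) (auto simp: power_law_def)
  then have "(\<lambda>n. exp (ln (a n) / ln (real n) * ln (real n))) \<longlonglongrightarrow> 0"
    by (rule filterlim_compose[OF exp_at_bot])
  moreover have "\<forall>\<^sub>F n in sequentially. exp (ln (a n) / ln (real n) * ln (real n)) = a n"
    using assms(1)[unfolded power_law_def, THEN conjunct1] eventually_gt_at_top[of 1]
    by eventually_elim simp
  ultimately show ?thesis by (rule Lim_transform_eventually)
qed

theorem theorem1p7: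
  fixes d :: nat and p :: "nat \<Rightarrow> real"
  assumes p_range: "\<And>n. n \<ge> 1 \<Longrightarrow> 0 < p n \<and> p n < 1"
    and p_asymp: "power_law p (- (2 / (real d + 1)^2))"
  shows "(\<lambda>n. pmf (random_degree n (p n)) d) \<longlonglongrightarrow> 1 \<and>
    (\<forall>d'. d' \<noteq> d \<longrightarrow>
      power_law (\<lambda>n. pmf (random_degree n (p n)) d')
        (- (((real d' - real d) / (real d + 1))^2)))"
proof -
  define m where "m = Suc d"
  define r where "r n = p n / (1 - p n)" for n
  \<comment> \<open>To base \<open>n\<close>, \<open>s n\<close> and \<open>t n\<close> are the
    exponents of \<open>r n\<close> and of the cluster ratio, and \<open>u n k\<close> is that of
    the degree estimate without its factor \<open>1 / fact k\<close>.\<close>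
  define s where "s n = ln (r n) / ln (real n)" for n
  define t where "t n = ln (cluster_ratio (r n) n) / ln (real n)" for n
  define f where "f n k = pmf (random_degree n (p n)) k" for n k
  define u where "u n k = real (Suc k choose 2) * s n + real (Suc k) * t n - 1" for n k
  \<comment> \<open>\<open>\<xi>\<close> is the value of \<open>t\<close> that makes
    \<open>u n d\<close> vanish when \<open>s\<close> takes its limit; \<open>\<epsilon>\<close> is
    the tolerance of \<open>exponent_bound\<close>.\<close>
  define \<xi> where "\<xi> = (2 * real m - 1) / (real m)\<^sup>2"
  define \<epsilon> where "\<epsilon> = 1 / (2 * (real m)\<^sup>2 * (real m + 1)\<^sup>2)"
  have m: "m > 0" "real m = real d + 1" by (auto simp: m_def)
  have p0: "p \<longlonglongrightarrow> 0"
    using p_asymp by (rule power_law_tendsto_0) simp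
  have L: "filterlim (\<lambda>n. ln (real n)) at_top sequentially" by real_asymp
  have L0: "(\<lambda>n. g n / ln (real n)) \<longlonglongrightarrow> 0" if "g \<longlonglongrightarrow> c" for g :: "nat \<Rightarrow> real" and c
    using that filterlim_at_top_imp_at_infinity[OF L] by (rule tendsto_divide_0)

  have ev: "\<forall>\<^sub>F n in sequentially. n \<ge> 2 \<and> 0 < p n \<and> p n \<le> 1 / 2 \<and> 0 < r n \<and> r n \<le> 1"
    using order_tendstoD(2)[OF p0, of "1/2", simplified] eventually_ge_at_top[of 2]
    by eventually_elim (use p_range in \<open>auto simp: r_def field_simps\<close>)

  \<comment> \<open>Dividing by \<open>1 - p n\<close>, which tends to 1, does not change the
    exponent.\<close>
  have s_lim: "s \<longlonglongrightarrow> - (2 / (real m)\<^sup>2)"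
  proof -
    have "(\<lambda>n. ln (1 - p n)) \<longlonglongrightarrow> ln (1 - 0)"
      by (intro tendsto_intros p0) auto
    then have "(\<lambda>n. ln (p n) / ln (real n) - ln (1 - p n) / ln (real n)) \<longlonglongrightarrow> - (2 / (real m)\<^sup>2) - 0"
      using p_asymp m by (intro tendsto_diff L0) (auto simp: power_law_def)
    moreover have "\<forall>\<^sub>F n in sequentially. ln (p n) / ln (real n) - ln (1 - p n) / ln (real n) = s n"
      using ev by eventually_elim (simp add: s_def r_def ln_div diff_divide_distrib)
    ultimately show ?thesis by (simp add: Lim_transform_eventually)
  qed

  have est: "\<forall>\<^sub>F n in sequentially. \<forall>k. degree_estimate (r n) n k = exp (ln (real n) * u n k) / fact k"
    using ev by eventually_elim (auto simp: degree_estimate_eq_exp u_def s_def t_def)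

  have f_pos: "\<forall>\<^sub>F n in sequentially. f n k > 0" for k
    using ev eventually_gt_at_top[of k]
  proof eventually_elim
    case (elim n)
    then show ?case
      using pmf_random_degree[of "p n" k n] cluster_coeff_pos[of "r n"] block_weight_pos[of "r n"]
      by (auto simp: f_def r_def)
  qed

  \<comment> \<open>For fixed \<open>k\<close> the two bounds on \<open>f n k\<close> differ from
    \<open>n\<close> to the power \<open>u n k\<close> by bounded factors, whose logarithms vanish
    after division by \<open>ln n\<close>.\<close>
  have f_lim: "(\<lambda>n. ln (f n k) / ln (real n) - u n k) \<longlonglongrightarrow> 0" for k
  proof (rule real_tendsto_sandwich)
    let ?l = "\<lambda>n. real (Suc k) * ln (real (n - Suc k) / real n) - ln (fact k)"
    have "(\<lambda>n. ln (real (n - Suc k) / real n)) \<longlonglongrightarrow> 0" by real_asymp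
    then have "?l \<longlonglongrightarrow> real (Suc k) * 0 - ln (fact k)"
      by (intro tendsto_intros)
    then show "(\<lambda>n. ?l n / ln (real n)) \<longlonglongrightarrow> 0" by (rule L0)
    show "(\<lambda>n. - ln (fact k) / ln (real n)) \<longlonglongrightarrow> 0" by (rule L0[OF tendsto_const])
    show "\<forall>\<^sub>F n in sequentially. ?l n / ln (real n) \<le> ln (f n k) / ln (real n) - u n k"
      using ev est f_pos[of k] eventually_gt_at_top[of "Suc k"]
    proof eventually_elim
      case (elim n)
      have q: "real (n - Suc k) / real n > 0" using elim by auto
      have "real (Suc k) * ln (real (n - Suc k) / real n) + (ln (real n) * u n k - ln (fact k))
        = ln ((real (n - Suc k) / real n) ^ Suc k * degree_estimate (r n) n k)"
        using elim q by (simp add: ln_mult ln_div ln_realpow del: power_Suc)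
      also have "\<dots> \<le> ln (f n k)"
        using pmf_random_degree_bounds(2)[of "p n" k n] elim q
        by (subst ln_le_cancel_iff) (auto simp: f_def r_def simp del: power_Suc)
      finally have "?l n \<le> ln (f n k) - ln (real n) * u n k" by simp
      then have "?l n / ln (real n) \<le> (ln (f n k) - ln (real n) * u n k) / ln (real n)"
        using elim by (intro divide_right_mono) auto
      then show ?case using elim by (simp add: diff_divide_distrib)
    qed
    show "\<forall>\<^sub>F n in sequentially. ln (f n k) / ln (real n) - u n k \<le> - ln (fact k) / ln (real n)"
      using ev est f_pos[of k] eventually_gt_at_top[of "Suc k"]
    proof eventually_elim
      case (elim n)
      have "ln (f n k) \<le> ln (degree_estimate (r n) n k)"
        using pmf_random_degree_bounds(1)[of "p n" k n] elim
        by (subst ln_le_cancel_iff) (auto simp: f_def r_def)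
      also have "\<dots> = ln (real n) * u n k - ln (fact k)"
        using elim by (simp add: ln_div)
      finally have "(ln (f n k) - ln (real n) * u n k) / ln (real n) \<le> - ln (fact k) / ln (real n)"
        using elim by (intro divide_right_mono) auto
      then show ?case using elim by (simp add: diff_divide_distrib)
    qed
  qed

  have t_eq: "t n = (u n d + 1 - real (m choose 2) * s n) / real m" for n
    by (simp add: u_def m_def)
  have \<xi>_eq: "(0 + 1 - real (m choose 2) * - (2 / (real m)\<^sup>2)) / real m = \<xi>"
    using m by (simp add: \<xi>_def real_choose_2 divide_simps) (simp add: algebra_simps power2_eq_square)

  \<comment> \<open>A probability is at most 1, so \<open>u n d\<close> is at most a quantity
    tending to 0; solving for \<open>t n\<close> gives a bound from above. The matching limit has to
    wait until degree \<open>d\<close> is known to dominate.\<close>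
  have t_le: "\<forall>\<^sub>F n in sequentially. t n \<le> \<xi> + \<epsilon>"
  proof -
    have "(\<lambda>n. (- (ln (f n d) / ln (real n) - u n d) + 1 - real (m choose 2) * s n) / real m)
        \<longlonglongrightarrow> (- 0 + 1 - real (m choose 2) * - (2 / (real m)\<^sup>2)) / real m"
      using m by (intro tendsto_intros f_lim s_lim) auto
    then have "(\<lambda>n. (- (ln (f n d) / ln (real n) - u n d) + 1 - real (m choose 2) * s n) / real m) \<longlonglongrightarrow> \<xi>"
      using \<xi>_eq by simp
    then have "\<forall>\<^sub>F n in sequentially.
        (- (ln (f n d) / ln (real n) - u n d) + 1 - real (m choose 2) * s n) / real m < \<xi> + \<epsilon>"
      by (rule order_tendstoD) (use m in \<open>auto simp: \<epsilon>_def\<close>)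
    then show ?thesis
      using ev f_pos[of d]
    proof eventually_elim
      case (elim n)
      have "ln (f n d) / ln (real n) \<le> 0"
        using elim pmf_le_1[of "random_degree n (p n)" d]
        by (intro divide_nonpos_nonneg) (auto simp: f_def)
      then have "t n \<le> (- (ln (f n d) / ln (real n) - u n d) + 1 - real (m choose 2) * s n) / real m"
        unfolding t_eq using m by (intro divide_right_mono) auto
      then show ?case using elim by simp
    qed
  qed

  have s_le: "\<forall>\<^sub>F n in sequentially. s n \<le> - (2 / (real m)\<^sup>2) + \<epsilon>"
    using order_tendstoD(2)[OF s_lim, of "- (2 / (real m)\<^sup>2) + \<epsilon>"] m
    by (auto simp: \<epsilon>_def elim: eventually_mono)

  have part1: "(\<lambda>n. f n d) \<longlonglongrightarrow> 1"
  proof (rule real_tendsto_sandwich)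
    let ?E = "\<lambda>n. exp (ln (real n) * - (1 / (2 * (real m)\<^sup>2)))"
    have "filterlim (\<lambda>n. - (1 / (2 * (real m)\<^sup>2)) * ln (real n)) at_bot sequentially"
      using m by (intro filterlim_tendsto_neg_mult_at_bot[OF tendsto_const _ L]) auto
    then have "?E \<longlonglongrightarrow> 0"
      by (intro filterlim_compose[OF exp_at_bot]) (simp add: mult.commute)
    then have "(\<lambda>n. 1 - ?E n * exp 1) \<longlonglongrightarrow> 1 - 0 * exp 1" by (intro tendsto_intros)
    then show "(\<lambda>n. 1 - ?E n * exp 1) \<longlonglongrightarrow> 1" by simp
    show "\<forall>\<^sub>F n in sequentially. 1 - ?E n * exp 1 \<le> f n d"
      using ev est t_le s_le eventually_gt_at_top[of d]
    proof eventually_elim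
      case (elim n)
      have "(\<Sum>k<n. f n k) = 1"
        unfolding f_def using elim cluster_coeff_pos[of "r n" n]
        by (intro sum_pmf_random_degree) (auto simp: r_def)
      then have "1 - f n d = (\<Sum>k\<in>{..<n} - {d}. f n k)"
        using elim by (simp add: sum_diff1)
      \<comment> \<open>Upper bounds on \<open>s\<close> and \<open>t\<close> suffice, as both enter
        \<open>u\<close> with nonnegative coefficients. \<open>exponent_bound\<close> is applied
        with \<open>q = Suc k\<close>, which differs from \<open>m\<close>; the factorials keep the
        sum over \<open>k\<close> bounded.\<close>
      also have "\<dots> \<le> (\<Sum>k\<in>{..<n} - {d}. ?E n * (1 / fact k))"
      proof (intro sum_mono)
        fix k assume k: "k \<in> {..<n} - {d}"
        have u: "u n k \<le> - (1 / (2 * (real m)\<^sup>2))"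
          unfolding u_def using k elim m
          by (intro exponent_bound) (auto simp: m_def \<xi>_def \<epsilon>_def)
        have "f n k \<le> degree_estimate (r n) n k"
          unfolding f_def r_def using k elim by (intro pmf_random_degree_bounds(1)) auto
        also have "\<dots> = exp (ln (real n) * u n k) / fact k" using elim by simp
        also have "\<dots> \<le> ?E n * (1 / fact k)"
          using elim u mult_left_mono[of "u n k" "- (1 / (2 * (real m)\<^sup>2))" "ln (real n)"]
          by (simp add: divide_right_mono)
        finally show "f n k \<le> ?E n * (1 / fact k)" .
      qed
      also have "\<dots> \<le> (\<Sum>k<n. ?E n * (1 / fact k))"
        by (intro sum_mono2) auto
      also have "\<dots> \<le> ?E n * exp 1"
        unfolding sum_distrib_left[symmetric]
        by (intro mult_left_mono sum_inverse_fact_le_exp exp_ge_zero)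
      finally show ?case by simp
    qed
    show "\<forall>\<^sub>F n in sequentially. f n d \<le> 1" by (simp add: f_def pmf_le_1)
  qed simp

  \<comment> \<open>Now \<open>ln (f n d)\<close> tends to 0, which forces \<open>u n d\<close> to 0
    and turns the upper bound on \<open>t\<close> into a limit.\<close>
  have t_lim: "t \<longlonglongrightarrow> \<xi>"
  proof -
    have "(\<lambda>n. ln (f n d)) \<longlonglongrightarrow> ln 1" by (intro tendsto_ln part1) simp
    then have "(\<lambda>n. ln (f n d) / ln (real n) - (ln (f n d) / ln (real n) - u n d)) \<longlonglongrightarrow> 0 - 0"
      by (intro tendsto_diff L0 f_lim)
    then have "(\<lambda>n. u n d) \<longlonglongrightarrow> 0" by simp
    then have "t \<longlonglongrightarrow> (0 + 1 - real (m choose 2) * - (2 / (real m)\<^sup>2)) / real m"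
      unfolding t_eq using m by (intro tendsto_intros s_lim) auto
    then show ?thesis unfolding \<xi>_eq .
  qed

  have "power_law (\<lambda>n. f n k) (- (((real k - real d) / (real d + 1))\<^sup>2))" for k
  proof -
    have "(\<lambda>n. ln (f n k) / ln (real n) - u n k + u n k) \<longlonglongrightarrow>
      0 + (real (Suc k choose 2) * - (2 / (real m)\<^sup>2) + real (Suc k) * \<xi> - 1)"
      by (intro tendsto_add f_lim) (unfold u_def, intro tendsto_intros s_lim t_lim)
    \<comment> \<open>The shift between degree and clique size cancels: \<open>Suc k - m\<close> is
      \<open>k - d\<close>.\<close>
    also have "0 + (real (Suc k choose 2) * - (2 / (real m)\<^sup>2) + real (Suc k) * \<xi> - 1)
      = - (((real k - real d) / (real d + 1))\<^sup>2)"
      using exponent_identity[of "real m" "Suc k"] m by (simp add: \<xi>_def)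
    finally show ?thesis using f_pos[of k] by (simp add: power_law_def)
  qed
  with part1 show ?thesis by (simp add: f_def)
qed

end
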